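(* Let $n\ge2$ and, for $r>0$, let $$\Omega_r=\Bigl\{w=(w^0,\dots,w^n)\in\mathbb{C}^{n+1}\ :\ \sum_{j=0}^n(\log|w^j|)^2<r^2\Bigr\}.$$ For $r,r^\prime>0$, the domains $\Omega_r$ and $\Omega_{r^\prime}$ are biholomorphic if and only if $r=r^\prime$.
   Context: In the definition of $\Omega_r$ it is understood that $w^j\neq0$ for all $j$. *)

theory Defs
  imports "HOL-Analysis.Analysis"
begin

(* Complex Frechet differentiability: the real derivative exists and is
   complex-linear, where c *s v is componentwise multiplication by c.  The
   derivative is taken in the full space, so the notion is meant for open S. *)
definition holomorphic_vec_on ::
    "(complex ^ 'n::finite \<Rightarrow> complex ^ 'm::finite) \<Rightarrow> (complex ^ 'n) set \<Rightarrow> bool" where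
  "holomorphic_vec_on f S \<longleftrightarrow>
     (\<forall>z\<in>S. \<exists>D. (f has_derivative D) (at z) \<and> (\<forall>c v. D (c *s v) = c *s D v))"

definition biholomorphic ::
    "(complex ^ 'n::finite) set \<Rightarrow> (complex ^ 'm::finite) set \<Rightarrow> bool" where
  "biholomorphic S T \<longleftrightarrow>
     (\<exists>f g. holomorphic_vec_on f S \<and> holomorphic_vec_on g T \<and>
        f ` S \<subseteq> T \<and> g ` T \<subseteq> S \<and>
        (\<forall>z\<in>S. g (f z) = z) \<and> (\<forall>w\<in>T. f (g w) = w))"

(* The condition w $ j \<noteq> 0 must be explicit because ln 0 = 0 in HOL. *)
definition Omega :: "real \<Rightarrow> (complex ^ 'n::finite) set" where
  "Omega r = {w. (\<forall>j. w $ j \<noteq> 0) \<and> (\<Sum>j\<in>UNIV. (ln (cmod (w $ j)))\<^sup>2) < r\<^sup>2}"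

end

theory Submission
  imports Defs "HOL-Complex_Analysis.Complex_Analysis"
begin

text \<open>
  Let \<open>f\<close> be biholomorphic from \<open>Omega r\<close> to \<open>Omega r'\<close>, and map the strip \<open>\<bar>Re z\<bar> < r\<close> to
  \<open>Omega r\<close> by \<open>z \<mapsto> (e\<^sup>z, 1, \<dots>, 1)\<close>. Along the strip the components of \<open>f\<close> have holomorphic
  logarithms \<open>L\<^sub>j\<close> with \<open>L\<^sub>j (z + 2\<pi>i) = L\<^sub>j z + 2\<pi>i k\<^sub>j\<close> for integers \<open>k\<^sub>j\<close>. They are not all zero:
  otherwise \<open>exp (s L\<^sub>j)\<close>, \<open>0 \<le> s \<le> 1\<close>, would contract the image loop in \<open>Omega r'\<close>, and the inverse
  of \<open>f\<close> would carry this to a contraction of the unit circle in the punctured plane. The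
  function \<open>\<Sum> k\<^sub>j L\<^sub>j\<close> has real part at most \<open>\<bar>k\<bar> r'\<close> in absolute value, and its mean over
  vertical periods is affine in \<open>Re z\<close> with slope \<open>\<bar>k\<bar>\<^sup>2\<close>; hence \<open>\<bar>k\<bar> r \<le> r'\<close>, so \<open>r \<le> r'\<close>.
  The converse inequality follows by symmetry.
\<close>

section \<open>Vertical strips, periods and logarithms\<close>

definition strip :: "real \<Rightarrow> complex set" where
  "strip r = {z. \<bar>Re z\<bar> < r}"

lemma mem_strip: "z \<in> strip r \<longleftrightarrow> \<bar>Re z\<bar> < r"
  by (simp add: strip_def)

lemma strip_eq: "strip r = {z. Re z < r} \<inter> {z. Re z > - r}"
  by (auto simp: strip_def)

lemma open_strip: "open (strip r)"
  unfolding strip_eq by (intro open_Int open_halfspace_Re_lt open_halfspace_Re_gt)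

lemma convex_strip: "convex (strip r)"
  unfolding strip_eq by (intro convex_Int convex_halfspace_Re_lt convex_halfspace_Re_gt)

lemma constant_on_strip:
  assumes "\<And>z. z \<in> strip r \<Longrightarrow> (f has_field_derivative 0) (at z)"
  obtains c where "\<And>z. z \<in> strip r \<Longrightarrow> f z = c"
  using has_field_derivative_zero_constant[OF convex_strip, of r f] assms
  by (meson has_field_derivative_at_within)

lemma add_period_strip: "z \<in> strip r \<Longrightarrow> z + 2 * pi * \<i> \<in> strip r"
  by (simp add: mem_strip)

lemma has_field_derivative_shift:
  fixes f :: "complex \<Rightarrow> complex"
  assumes "(f has_field_derivative D) (at (z + a))"
  shows "((\<lambda>z. f (z + a)) has_field_derivative D) (at z)"
  using assms by (simp add: DERIV_shift)

text \<open>Subtracting \<open>m * z\<close> leaves a periodic function, whose mean over a vertical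
  period does not depend on \<open>Re z\<close>. So \<open>Re L\<close> has mean constant plus
  \<open>m * x\<close> on the line \<open>Re z = x\<close>; comparing \<open>x\<close> with
  \<open>-x\<close> removes the constant.\<close>

lemma quasi_periodic_slope_bound:
  fixes L :: "complex \<Rightarrow> complex" and m B r :: real
  assumes r: "r > 0" and hol: "L holomorphic_on strip r"
    and per: "\<And>z. z \<in> strip r \<Longrightarrow> L (z + 2 * pi * \<i>) = L z + 2 * pi * \<i> * m"
    and bd: "\<And>z. z \<in> strip r \<Longrightarrow> \<bar>Re (L z)\<bar> \<le> B"
  shows "\<bar>m\<bar> * r \<le> B"
proof -
  define G where "G z = L z - m * z" for z :: complex
  have "G holomorphic_on strip r"
    unfolding G_def by (intro holomorphic_intros hol)
  then obtain F where F: "\<And>z. z \<in> strip r \<Longrightarrow> (F has_field_derivative G z) (at z)"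
    by (metis holomorphic_convex_primitive'[OF convex_strip open_strip] at_within_open open_strip)
  have Gper: "G (z + 2 * pi * \<i>) = G z" if "z \<in> strip r" for z
    using per[OF that] by (simp add: G_def algebra_simps)
  have "((\<lambda>z. F (z + 2 * pi * \<i>) - F z) has_field_derivative 0) (at z)" if z: "z \<in> strip r" for z
    using DERIV_diff[OF has_field_derivative_shift[OF F[OF add_period_strip[OF z]]] F[OF z]]
    unfolding Gper[OF z] by simp
  then obtain c where c: "\<And>z. z \<in> strip r \<Longrightarrow> F (z + 2 * pi * \<i>) - F z = c"
    using constant_on_strip by blast
  \<comment> \<open>\<open>c\<close> is \<open>2\<pi>i\<close> times the mean of \<open>G\<close> over a period; the mean value theorem for the primitive
    avoids integrals.\<close>
  have key: "\<bar>Im c / (2 * pi) + m * x\<bar> \<le> B" if x: "\<bar>x\<bar> < r" for x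
  proof -
    \<comment> \<open>Along the vertical line \<open>F\<close> has derivative
      \<open>\<i> * G\<close>, whose imaginary part is \<open>Re G\<close>.\<close>
    define \<phi> where "\<phi> t = Im (F (x + t * \<i>))" for t :: real
    have st: "x + t * \<i> \<in> strip r" for t :: real
      using x by (simp add: mem_strip)
    have "(\<phi> has_real_derivative Re (G (x + t * \<i>))) (at t)" for t :: real
    proof -
      have "((\<lambda>u::real. F (x + u * \<i>)) has_vector_derivative (\<i> * G (x + t * \<i>))) (at t)"
      proof -
        have "((\<lambda>u::real. x + u * \<i>) has_vector_derivative \<i>) (at t)"
          by (auto simp: has_vector_derivative_def scaleR_conv_of_real intro!: derivative_eq_intros)
        from field_vector_diff_chain_at[where g = F, OF this F[OF st]] show ?thesis
          by (simp add: o_def)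
      qed
      from bounded_linear.has_vector_derivative[OF bounded_linear_Im this]
      show ?thesis
        unfolding \<phi>_def by (simp add: has_real_derivative_iff_has_vector_derivative)
    qed
    then obtain t :: real where "\<phi> (2 * pi) - \<phi> 0 = (2 * pi - 0) * Re (G (x + t * \<i>))"
      using MVT2[of 0 "2 * pi" \<phi> "\<lambda>t::real. Re (G (x + t * \<i>))"] by auto
    moreover have "\<phi> (2 * pi) - \<phi> 0 = Im c"
      using c[OF st[of 0]] by (simp add: \<phi>_def flip: minus_complex.sel)
    ultimately have "Im c / (2 * pi) = Re (G (x + t * \<i>))"
      by (simp add: field_simps)
    then show ?thesis
      using bd[OF st[of t]] by (simp add: G_def)
  qed
  have bound: "\<bar>m\<bar> * x \<le> B" if "0 < x" "x < r" for x
    using key[of x] key[of "-x"] that by (cases "m \<ge> 0") (auto simp: abs_if split: if_splits)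
  show ?thesis
  \<comment> \<open>The lines \<open>Re z = r\<close> and \<open>Re z = -r\<close> lie outside the
    strip, so the bound at \<open>t * r\<close> is used for all \<open>t < 1\<close>.\<close>
  proof (rule field_le_mult_one_interval)
    fix t :: real assume "0 < t" "t < 1"
    then show "t * (\<bar>m\<bar> * r) \<le> B"
      using bound[of "t * r"] r by (simp add: mult.left_commute)
  qed
qed

text \<open>Convexity of the strip gives a logarithm. Its increment \<open>D\<close> over a period
  satisfies \<open>exp (D z) = 1\<close>; differentiating gives \<open>D' = 0\<close>, so a single
  integer \<open>k\<close> serves the whole strip.\<close>

lemma periodic_logarithm:
  assumes r: "r > 0" and hol: "h holomorphic_on strip r"
    and nz: "\<And>z. z \<in> strip r \<Longrightarrow> h z \<noteq> 0"
    and per: "\<And>z. h (z + 2 * pi * \<i>) = h z"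
  shows "\<exists>L (k::int). L holomorphic_on strip r \<and> (\<forall>z\<in>strip r. exp (L z) = h z) \<and>
    (\<forall>z\<in>strip r. L (z + 2 * pi * \<i>) = L z + 2 * pi * \<i> * k)"
proof -
  have 0: "0 \<in> strip r"
    using r by (simp add: mem_strip)
  obtain L where L: "L holomorphic_on strip r" "\<And>z. z \<in> strip r \<Longrightarrow> exp (L z) = h z"
    using holomorphic_logarithm_exists[OF convex_strip open_strip hol nz 0] by blast
  define D where "D z = L (z + 2 * pi * \<i>) - L z" for z
  have exp1: "exp (D z) = 1" if "z \<in> strip r" for z
    using that L(2) add_period_strip per nz by (simp add: D_def exp_diff)
  have "(D has_field_derivative 0) (at z)" if z: "z \<in> strip r" for z
  proof -
    define D' where "D' = deriv L (z + 2 * pi * \<i>) - deriv L z"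
    have D: "(D has_field_derivative D') (at z)"
      unfolding D_def D'_def
      by (intro DERIV_diff has_field_derivative_shift holomorphic_derivI[OF L(1) open_strip] z
            add_period_strip)
    have "((\<lambda>z. exp (D z)) has_field_derivative exp (D z) * D') (at z)"
      by (rule DERIV_chain2[OF DERIV_exp D])
    moreover have "((\<lambda>z. exp (D z)) has_field_derivative 0) (at z)"
      by (rule has_field_derivative_transform_within_open[OF DERIV_const open_strip z])
         (simp add: exp1)
    ultimately have "D' = 0"
      using DERIV_unique by fastforce
    with D show ?thesis by simp
  qed
  then obtain c where c: "\<And>z. z \<in> strip r \<Longrightarrow> D z = c"
    using constant_on_strip by blast
  obtain k :: int where k: "Re c = 0" "Im c = of_int (2 * k) * pi"
    using exp1[OF 0] unfolding c[OF 0] exp_eq_1 by blast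
  have "c = 2 * pi * \<i> * k"
    using k by (simp add: complex_eq_iff)
  then show ?thesis
    using L c by (intro exI[of _ L] exI[of _ k]) (auto simp: D_def algebra_simps)
qed

section \<open>Holomorphic maps along coordinate lines, and \<open>Omega r\<close> in logarithmic
  coordinates\<close>

text \<open>By the chain rule and complex linearity of \<open>D\<close>, the derivative is
  multiplication by the number \<open>deriv h z * D (axis i 1) $ j\<close>.\<close>

lemma holomorphic_component_comp_axis:
  fixes f :: "complex ^ 'n::finite \<Rightarrow> complex ^ 'm::finite"
  assumes f: "holomorphic_vec_on f T" and h: "h holomorphic_on S" and "open S"
    and sub: "\<And>z. z \<in> S \<Longrightarrow> w + axis i (h z) \<in> T"
  shows "(\<lambda>z. f (w + axis i (h z)) $ j) holomorphic_on S"
  unfolding holomorphic_on_open[OF \<open>open S\<close>]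
proof
  fix z assume z: "z \<in> S"
  obtain D where D: "(f has_derivative D) (at (w + axis i (h z)))"
      and Dl: "\<And>c v. D (c *s v) = c *s D v"
    using f sub[OF z] unfolding holomorphic_vec_on_def by blast
  have hz: "(h has_derivative (\<lambda>v. deriv h z * v)) (at z)"
    using holomorphic_derivI[OF h \<open>open S\<close> z] by (simp add: has_field_derivative_def)
  have "bounded_linear (axis i :: complex \<Rightarrow> complex ^ 'n)"
    unfolding linear_conv_bounded_linear[symmetric]
    by (rule linearI) (auto simp: axis_def vec_eq_iff)
  then have "((\<lambda>z. w + axis i (h z)) has_derivative (\<lambda>v. axis i (deriv h z * v))) (at z)"
    by (auto intro!: derivative_eq_intros bounded_linear.has_derivative[OF _ hz])
  from bounded_linear.has_derivative[OF bounded_linear_vec_nth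
      diff_chain_at[OF this D, unfolded o_def]]
  have "((\<lambda>z. f (w + axis i (h z)) $ j) has_derivative
      (\<lambda>v. D (axis i (deriv h z * v)) $ j)) (at z)" .
  moreover have "D (axis i (deriv h z * v)) $ j = (deriv h z * D (axis i 1) $ j) * v" for v
  proof -
    have "axis i (deriv h z * v) = (deriv h z * v) *s axis i (1::complex)"
      by (auto simp: axis_def vec_eq_iff)
    then show ?thesis
      by (simp add: Dl)
  qed
  ultimately show "\<exists>f'. ((\<lambda>z. f (w + axis i (h z)) $ j) has_field_derivative f') (at z)"
    unfolding has_field_derivative_def by auto
qed

lemma holomorphic_vec_on_imp_continuous_on:
  "holomorphic_vec_on f S \<Longrightarrow> continuous_on S f"
  unfolding holomorphic_vec_on_def
  by (meson continuous_at_imp_continuous_on has_derivative_continuous)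

lemma mem_Omega_exp:
  "(\<chi> j. exp (L j)) \<in> Omega r \<longleftrightarrow> (\<Sum>j\<in>UNIV. (Re (L j))\<^sup>2) < r\<^sup>2"
  by (simp add: Omega_def)

text \<open>In logarithmic coordinates \<open>Omega r\<close> is a tube over a ball centred at 0,
  and such a ball is star-shaped.\<close>

lemma Omega_exp_contract:
  assumes "(\<chi> j. exp (L j)) \<in> Omega r" and "0 \<le> s" "s \<le> 1"
  shows "(\<chi> j. exp (of_real s * L j)) \<in> Omega r"
proof -
  have "(\<Sum>j\<in>UNIV. (Re (of_real s * L j))\<^sup>2) \<le> (\<Sum>j\<in>UNIV. (Re (L j))\<^sup>2)"
  proof (rule sum_mono)
    fix j
    have "s\<^sup>2 * (Re (L j))\<^sup>2 \<le> 1 * (Re (L j))\<^sup>2"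
      using assms by (intro mult_right_mono) (auto simp: power_le_one)
    then show "(Re (of_real s * L j))\<^sup>2 \<le> (Re (L j))\<^sup>2"
      by (simp add: power_mult_distrib)
  qed
  then show ?thesis
    using assms(1) unfolding mem_Omega_exp by linarith
qed

text \<open>The first coordinate is the homotopy parameter. The winding number about 0 would be
  invariant, yet it is 0 for a constant loop and 1 for the circle.\<close>

lemma circle_not_contractible:
  fixes h :: "real \<times> real \<Rightarrow> complex"
  assumes cont: "continuous_on ({0..1} \<times> {0..1}) h"
    and nz: "\<And>x. x \<in> {0..1} \<times> {0..1} \<Longrightarrow> h x \<noteq> 0"
    and const: "\<And>t. t \<in> {0..1} \<Longrightarrow> h (0, t) = a"
    and circ: "\<And>t. t \<in> {0..1} \<Longrightarrow> h (1, t) = exp (2 * pi * \<i> * t)"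
    and loop: "\<And>s. s \<in> {0..1} \<Longrightarrow> h (s, 1) = h (s, 0)"
  shows False
proof -
  have "homotopic_loops (- {0}) (linepath a a) (circlepath 0 1)"
    unfolding homotopic_loops
  proof (intro exI[of _ h] conjI ballI)
    show "h \<in> {0..1} \<times> {0..1} \<rightarrow> - {0}"
      using nz by blast
    show "pathfinish (h \<circ> Pair t) = pathstart (h \<circ> Pair t)" if "t \<in> {0..1}" for t
      using loop[OF that] by (simp add: pathfinish_def pathstart_def)
  qed (use cont const circ in \<open>simp_all add: circlepath linepath_refl\<close>)
  then have "winding_number (linepath a a) 0 = winding_number (circlepath 0 1) 0"
    by (rule winding_number_homotopic_loops)
  moreover have "a \<noteq> 0"
    using nz[of "(0, 0)"] const[of 0] by auto
  ultimately show False
    by (simp add: winding_number_circlepath_centre)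
qed

section \<open>Comparison of the radii\<close>

lemma biholomorphic_Omega_imp_le:
  fixes r r' :: real
  assumes bih: "biholomorphic (Omega r :: (complex ^ 'i::finite) set) (Omega r' :: (complex ^ 'i) set)"
    and r: "r > 0" and r': "r' > 0"
  shows "r \<le> r'"
proof -
  obtain f g where f: "holomorphic_vec_on f (Omega r :: (complex ^ 'i) set)"
    and g: "holomorphic_vec_on g (Omega r' :: (complex ^ 'i) set)"
    and fS: "f ` Omega r \<subseteq> Omega r'" and gS: "g ` Omega r' \<subseteq> Omega r"
    and gf: "\<And>z. z \<in> Omega r \<Longrightarrow> g (f z) = z"
    using bih unfolding biholomorphic_def by blast
  fix i :: 'i
  \<comment> \<open>The entry 0 at \<open>i\<close> leaves room for \<open>axis i (exp z)\<close>,
    the form that \<open>holomorphic_component_comp_axis\<close> expects.\<close>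
  define w :: "complex ^ 'i" where "w = (\<chi> j. if j = i then 0 else 1)"
  define e where "e z = w + axis i (exp z)" for z
  have e_nth: "e z $ j = (if j = i then exp z else 1)" for z j
    by (simp add: e_def w_def axis_def)
  have e_mem: "e z \<in> Omega r" if "z \<in> strip r" for z
  proof -
    have "(\<Sum>j\<in>UNIV. (ln (cmod (e z $ j)))\<^sup>2) = (\<Sum>j\<in>UNIV. if j = i then (Re z)\<^sup>2 else 0)"
      by (intro sum.cong) (auto simp: e_nth)
    also have "\<dots> = (Re z)\<^sup>2" by simp
    also have "\<dots> < r\<^sup>2"
      using that power_strict_mono[of "\<bar>Re z\<bar>" r 2] by (simp add: mem_strip)
    finally show ?thesis
      by (auto simp: Omega_def e_nth)
  qed
  have fe_mem: "f (e z) \<in> Omega r'" if "z \<in> strip r" for z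
    using e_mem[OF that] fS by blast
  have "\<exists>L (k::int). L holomorphic_on strip r \<and> (\<forall>z\<in>strip r. exp (L z) = f (e z) $ j) \<and>
    (\<forall>z\<in>strip r. L (z + 2 * pi * \<i>) = L z + 2 * pi * \<i> * k)" for j
  proof (rule periodic_logarithm[OF r])
    show "(\<lambda>z. f (e z) $ j) holomorphic_on strip r"
      unfolding e_def
      by (rule holomorphic_component_comp_axis[OF f _ open_strip])
         (use e_mem in \<open>auto simp: e_def intro!: holomorphic_intros\<close>)
    show "f (e z) $ j \<noteq> 0" if "z \<in> strip r" for z
      using fe_mem[OF that] by (simp add: Omega_def)
    show "f (e (z + 2 * pi * \<i>)) $ j = f (e z) $ j" for z
      by (simp add: e_def exp_add)
  qed
  then obtain L :: "'i \<Rightarrow> complex \<Rightarrow> complex" and k :: "'i \<Rightarrow> int"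
    where Lhol: "\<And>j. L j holomorphic_on strip r"
      and Lexp: "\<And>j z. z \<in> strip r \<Longrightarrow> exp (L j z) = f (e z) $ j"
      and Lper: "\<And>j z. z \<in> strip r \<Longrightarrow> L j (z + 2 * pi * \<i>) = L j z + 2 * pi * \<i> * k j"
    by metis
  have Lvec: "(\<chi> j. exp (L j z)) = f (e z)" if "z \<in> strip r" for z
    using Lexp[OF that] by (simp add: vec_eq_iff)
  have "\<exists>j. k j \<noteq> 0"
  proof (rule ccontr)
    assume "\<nexists>j. k j \<noteq> 0"
    then have k0: "k j = 0" for j by auto
    \<comment> \<open>\<open>z\<close> runs through one period, which \<open>e\<close> maps to the
      unit circle in coordinate \<open>i\<close>.\<close>
    define z where "z t = 2 * pi * \<i> * of_real t" for t :: real
    \<comment> \<open>Scaling the logarithms shrinks the image loop to the point with all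
      coordinates 1; the intermediate curves stay closed because every \<open>k j\<close> is
      0.\<close>
    define H where "H p = (\<chi> j. exp (of_real (fst p) * L j (z (snd p))))" for p
    have z_mem: "z t \<in> strip r" for t
      using r by (simp add: z_def mem_strip)
    have H_mem: "H p \<in> Omega r'" if "p \<in> {0..1} \<times> {0..1}" for p
      unfolding H_def
      by (rule Omega_exp_contract) (use that fe_mem[OF z_mem] in \<open>auto simp: Lvec[OF z_mem]\<close>)
    have "continuous_on ({0..1} \<times> {0..1}) H"
      unfolding H_def
      by (intro continuous_intros continuous_on_compose2[OF holomorphic_on_imp_continuous_on[OF Lhol]])
         (use z_mem in \<open>auto simp: z_def intro!: continuous_intros\<close>)
    then have "continuous_on ({0..1} \<times> {0..1}) (\<lambda>p. g (H p) $ i)"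
      by (intro continuous_intros continuous_on_compose2[OF holomorphic_vec_on_imp_continuous_on[OF g]])
         (use H_mem in auto)
    then show False
    proof (rule circle_not_contractible)
      show "g (H p) $ i \<noteq> 0" if "p \<in> {0..1} \<times> {0..1}" for p
        using H_mem[OF that] gS by (auto simp: Omega_def)
      show "g (H (0, t)) $ i = g (\<chi> j. 1) $ i" for t
        by (simp add: H_def)
      show "g (H (1, t)) $ i = exp (2 * pi * \<i> * t)" for t
        using gf[OF e_mem[OF z_mem[of t]]] by (simp add: H_def Lvec[OF z_mem] e_nth) (simp add: z_def)
      have "L j (z 1) = L j (z 0)" for j
        using Lper[OF z_mem[of 0], of j] by (simp add: z_def k0)
      then show "g (H (s, 1)) $ i = g (H (s, 0)) $ i" for s
        by (simp add: H_def)
    qed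
  qed
  then obtain j0 where j0: "k j0 \<noteq> 0" by blast
  define q where "q = (\<Sum>j\<in>UNIV. (real_of_int (k j))\<^sup>2)"
  have "1 \<le> (real_of_int (k j0))\<^sup>2"
    using j0 by (metis of_int_1_le_iff of_int_power int_one_le_iff_zero_less zero_less_power2)
  also have "\<dots> \<le> q"
    unfolding q_def by (rule member_le_sum) auto
  finally have q1: "1 \<le> q" .
  \<comment> \<open>Weighting \<open>L j\<close> by its own \<open>k j\<close> gives period
    coefficient \<open>q\<close>, while Cauchy-Schwarz bounds the real part by
    \<open>sqrt q * r'\<close>.\<close>
  have "\<bar>q\<bar> * r \<le> sqrt q * r'"
  proof (rule quasi_periodic_slope_bound[OF r])
    show "(\<lambda>z. \<Sum>j\<in>UNIV. k j * L j z) holomorphic_on strip r"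
      by (intro holomorphic_intros Lhol)
  next
    fix z assume z: "z \<in> strip r"
    show "(\<Sum>j\<in>UNIV. k j * L j (z + 2 * pi * \<i>)) = (\<Sum>j\<in>UNIV. k j * L j z) + 2 * pi * \<i> * q"
      unfolding Lper[OF z] by (simp add: q_def algebra_simps sum.distrib sum_distrib_left power2_eq_square)
    have "(\<Sum>j\<in>UNIV. (Re (L j z))\<^sup>2) < r'\<^sup>2"
      using fe_mem[OF z] unfolding Lvec[OF z, symmetric] mem_Omega_exp .
    then have "L2_set (\<lambda>j. Re (L j z)) UNIV \<le> r'"
      using r' unfolding L2_set_def by (intro real_le_lsqrt) (auto simp: sum_nonneg)
    then have "L2_set (\<lambda>j. real_of_int (k j)) UNIV * L2_set (\<lambda>j. Re (L j z)) UNIV \<le> sqrt q * r'"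
      unfolding q_def L2_set_def[of "\<lambda>j. real_of_int (k j)"]
      by (intro mult_left_mono) (auto simp: sum_nonneg)
    moreover have "\<bar>\<Sum>j\<in>UNIV. k j * Re (L j z)\<bar> \<le> (\<Sum>j\<in>UNIV. \<bar>real_of_int (k j)\<bar> * \<bar>Re (L j z)\<bar>)"
      by (rule order_trans[OF sum_abs]) (simp add: abs_mult)
    ultimately show "\<bar>Re (\<Sum>j\<in>UNIV. k j * L j z)\<bar> \<le> sqrt q * r'"
      using L2_set_mult_ineq[of "\<lambda>j. real_of_int (k j)" "\<lambda>j. Re (L j z)" UNIV] by simp
  qed
  then have "sqrt q * (sqrt q * r) \<le> sqrt q * r'"
    using q1 by (simp flip: mult.assoc)
  then have "sqrt q * r \<le> r'"
    using q1 by (simp add: mult_le_cancel_left)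
  moreover have "1 * r \<le> sqrt q * r"
    using q1 r by (intro mult_right_mono) auto
  ultimately show ?thesis by simp
qed

lemma biholomorphic_refl: "biholomorphic S S"
proof -
  have "holomorphic_vec_on (\<lambda>z. z) S"
    unfolding holomorphic_vec_on_def
    by (intro ballI exI[of _ "\<lambda>z. z"]) auto
  then show ?thesis
    unfolding biholomorphic_def by (intro exI[of _ "\<lambda>z. z"]) auto
qed

lemma biholomorphic_sym: "biholomorphic S T \<Longrightarrow> biholomorphic T S"
  unfolding biholomorphic_def by blast

theorem corollary1p8:
  fixes n :: nat and r r' :: real
  assumes "n \<ge> 2"
    and "CARD('i::finite) = n + 1"
    and "r > 0" and "r' > 0"
  shows "biholomorphic (Omega r :: (complex ^ 'i) set) (Omega r' :: (complex ^ 'i) set)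
           \<longleftrightarrow> r = r'"
  using biholomorphic_Omega_imp_le[of r r', where 'i = 'i]
    biholomorphic_Omega_imp_le[of r' r, where 'i = 'i]
    biholomorphic_sym biholomorphic_refl assms(3,4) by (metis order_antisym)

end
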